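(* Let $X$ be a geodesic metric space equipped with a $(\lambda_0,\kappa_0)$-quasi-geodesic, $(C_0,k)$-navigable, undirected path system $\mathcal P$. Assume that for every point $x\in X$ there is a sequence of special paths $h_j\in\mathcal P$, $h_j$ joining points $a_j$ and $b_j$, each intersecting the ball $B(x,\kappa_0)$, such that the distances from $x$ to $a_j$ and from $x$ to $b_j$ both diverge to $\infty$. Assume that there exist $\delta,\epsilon$, a constant $C>0$ and a sequence $n_j\to\infty$ such that $\mathrm{Div}_\epsilon(n_j,\delta)\le Cn_j$ for all $j$. Then there exist $C'>0$, $\delta'$, $\epsilon'$ such that $\mathrm{Div}_{\epsilon'}(n,\delta')\le C'n$ for every $n$.
   Context: A $(\lambda,\kappa)$-quasi-geodesic ($\lambda\ge1,\kappa\ge0$) is a map $\gamma:I\to X$, $I\subseteq\mathbb R$ an interval, with $\frac1\lambda|t_1-t_2|-\kappa\le d(\gamma(t_1),\gamma(t_2))\le\lambda|t_1-t_2|+\kappa$. Convention: all quasi-geodesics are improved, i.e. continuous and such that the length of $\gamma|_{[t,t']}$ is at most $k_1d(\gamma(t),\gamma(t'))+k_2$, where $\kappa'=2(\lambda+\kappa)$, $k_1=\lambda(\lambda+\kappa)$, $k_2=(\lambda\kappa'+3)(\lambda+\kappa)$. For $p:[a,b]\to X$: $p^-=p(a)$, $p^+=p(b)$, $\|p\|$ is the length, $p^{-1}$ the reversed path. $B(m,r)$ is the closed ball. A $(\lambda_0,\kappa_0)$-quasi-geodesic path system $\mathcal P$ on $X$ is a set of $(\lambda_0,\kappa_0)$-quasi-geodesic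 segments containing all trivial paths, closed under passing to subsegments, and containing for all $x,y\in X$ a path from $x$ to $y$. Its elements are called special paths. It is undirected if closed under $h\mapsto h^{-1}$. An $(n,\mathcal P)$-polygonal line is a concatenation of at most $n$ special paths. $\mathcal P$ is $(C_0,k)$-navigable ($C_0\ge1$, $k\ge1$ an integer) if for every $R\ge C_0$, $m\in X$, $n$, and $(n,\mathcal P)$-polygonal line $\alpha$ with $d(\alpha,m)\ge R$ and $d(\alpha^\pm,m)\le2R$, there is a $(kn,\mathcal P)$-polygonal line $p$ with the same endpoints as $\alpha$, $\|p\|\le C_0nR$, avoiding $B(m,R/C_0)$. For $0<\delta<1$, $\epsilon>0$ and $a,b,c\in X$, $\mathrm{div}_\epsilon(a,b,c;\delta)$ is the infimum of the lengths of paths $p$ from $a$ to $b$ with $d(p,c)\ge\delta\,d(c,\{a,b\})-\epsilon$; $\mathrm{Div}_\epsilon(n,\delta)$ is the supremum of $\mathrm{div}_\epsilon(a,b,c;\delta)$ over all $a,b,c\in X$ with $d(a,b)\le n$. *)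

theory Defs
  imports "HOL-Analysis.Analysis"
begin

definition geodesic_space :: "'a::metric_space itself \<Rightarrow> bool" where
  "geodesic_space _ \<longleftrightarrow>
     (\<forall>x y::'a. \<exists>g. g 0 = x \<and> g (dist x y) = y \<and>
        (\<forall>s\<in>{0..dist x y}. \<forall>t\<in>{0..dist x y}. dist (g s) (g t) = \<bar>s - t\<bar>))"

definition curve_length :: "real \<Rightarrow> real \<Rightarrow> (real \<Rightarrow> 'a::metric_space) \<Rightarrow> ennreal" where
  "curve_length a b f =
     (SUP ts\<in>{ts. sorted ts \<and> set ts \<subseteq> {a..b}}.
        \<Sum>i<length ts - 1. ennreal (dist (f (ts ! i)) (f (ts ! Suc i))))"

text \<open>
  Besides the two quasi-isometry inequalities, the definition contains the convention that every
  quasi-geodesic is improved: it is continuous, and the length of each of its subsegments is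
  bounded affinely, with explicit constants, by the distance of the endpoints.
\<close>

definition quasi_geodesic :: "real \<Rightarrow> real \<Rightarrow> real set \<Rightarrow> (real \<Rightarrow> 'a::metric_space) \<Rightarrow> bool" where
  "quasi_geodesic lam kap I g \<longleftrightarrow>
     1 \<le> lam \<and> 0 \<le> kap \<and> is_interval I \<and>
     (\<forall>t1\<in>I. \<forall>t2\<in>I. \<bar>t1 - t2\<bar> / lam - kap \<le> dist (g t1) (g t2) \<and>
                     dist (g t1) (g t2) \<le> lam * \<bar>t1 - t2\<bar> + kap) \<and>
     continuous_on I g \<and>
     (let kap' = 2 * (lam + kap);
          k1 = lam * (lam + kap);
          k2 = (lam * kap' + 3) * (lam + kap)
      in \<forall>t\<in>I. \<forall>t'\<in>I. t \<le> t' \<longrightarrow>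
           curve_length t t' g \<le> ennreal (k1 * dist (g t) (g t') + k2))"

text \<open>
  \<open>Segment a b f\<close> stands for the map \<open>f : [a,b] \<rightarrow> X\<close>. The predicate \<open>is_path\<close> demands that
  \<open>f\<close> is extensional on \<open>[a,b]\<close>, so that two paths are equal iff they are equal as maps.
\<close>

datatype 'a segment = Segment (seg_lo: real) (seg_hi: real) (seg_fun: "real \<Rightarrow> 'a")

definition seg_dom :: "'a segment \<Rightarrow> real set" where
  "seg_dom p = {seg_lo p..seg_hi p}"

definition is_path :: "'a::metric_space segment \<Rightarrow> bool" where
  "is_path p \<longleftrightarrow> seg_lo p \<le> seg_hi p \<and> seg_fun p \<in> extensional (seg_dom p) \<and>
     continuous_on (seg_dom p) (seg_fun p)"

definition seg_start :: "'a segment \<Rightarrow> 'a" where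
  "seg_start p = seg_fun p (seg_lo p)"

definition seg_end :: "'a segment \<Rightarrow> 'a" where
  "seg_end p = seg_fun p (seg_hi p)"

definition seg_image :: "'a segment \<Rightarrow> 'a set" where
  "seg_image p = seg_fun p ` seg_dom p"

definition seg_length :: "'a::metric_space segment \<Rightarrow> ennreal" where
  "seg_length p = curve_length (seg_lo p) (seg_hi p) (seg_fun p)"

definition trivial_seg :: "real \<Rightarrow> 'a \<Rightarrow> 'a segment" where
  "trivial_seg t x = Segment t t (\<lambda>s\<in>{t..t}. x)"

definition subseg :: "'a segment \<Rightarrow> real \<Rightarrow> real \<Rightarrow> 'a segment" where
  "subseg p c d = Segment c d (restrict (seg_fun p) {c..d})"

definition reverse_seg :: "'a segment \<Rightarrow> 'a segment" where
  "reverse_seg p =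
     Segment (seg_lo p) (seg_hi p) (\<lambda>t\<in>seg_dom p. seg_fun p (seg_lo p + seg_hi p - t))"

text \<open>The domain of the second path is translated so as to start where that of the first ends.\<close>

definition join_seg :: "'a segment \<Rightarrow> 'a segment \<Rightarrow> 'a segment" where
  "join_seg p q =
     (let b = seg_hi p + (seg_hi q - seg_lo q)
      in Segment (seg_lo p) b
           (\<lambda>t\<in>{seg_lo p..b}. if t \<le> seg_hi p then seg_fun p t
                              else seg_fun q (t - seg_hi p + seg_lo q)))"

inductive concatenation :: "'a segment list \<Rightarrow> 'a segment \<Rightarrow> bool" where
  single: "concatenation [h] h"
| join: "concatenation hs p \<Longrightarrow> seg_end h = seg_start p \<Longrightarrow> concatenation (h # hs) (join_seg h p)"

definition path_system :: "real \<Rightarrow> real \<Rightarrow> 'a::metric_space segment set \<Rightarrow> bool" where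
  "path_system lam0 kap0 P \<longleftrightarrow>
     (\<forall>h\<in>P. is_path h \<and> quasi_geodesic lam0 kap0 (seg_dom h) (seg_fun h)) \<and>
     (\<forall>t x. trivial_seg t x \<in> P) \<and>
     (\<forall>h\<in>P. \<forall>c d. seg_lo h \<le> c \<and> c \<le> d \<and> d \<le> seg_hi h \<longrightarrow> subseg h c d \<in> P) \<and>
     (\<forall>x y. \<exists>h\<in>P. seg_start h = x \<and> seg_end h = y)"

definition undirected :: "'a segment set \<Rightarrow> bool" where
  "undirected P \<longleftrightarrow> (\<forall>h\<in>P. reverse_seg h \<in> P)"

definition polygonal_line :: "nat \<Rightarrow> 'a segment set \<Rightarrow> 'a segment \<Rightarrow> bool" where
  "polygonal_line n P p \<longleftrightarrow> (\<exists>hs. length hs \<le> n \<and> set hs \<subseteq> P \<and> concatenation hs p)"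

definition navigable :: "real \<Rightarrow> nat \<Rightarrow> 'a::metric_space segment set \<Rightarrow> bool" where
  "navigable C0 k P \<longleftrightarrow> 1 \<le> C0 \<and> 1 \<le> k \<and>
     (\<forall>R m n \<alpha>. C0 \<le> R \<and> polygonal_line n P \<alpha> \<and> R \<le> infdist m (seg_image \<alpha>) \<and>
          dist (seg_start \<alpha>) m \<le> 2 * R \<and> dist (seg_end \<alpha>) m \<le> 2 * R \<longrightarrow>
        (\<exists>p. polygonal_line (k * n) P p \<and>
             seg_start p = seg_start \<alpha> \<and> seg_end p = seg_end \<alpha> \<and>
             seg_length p \<le> ennreal (C0 * real n * R) \<and>
             seg_image p \<inter> cball m (R / C0) = {}))"

text \<open>Here \<open>infdist c (seg_image p)\<close> is \<open>d(p,c)\<close>; the infimum of the empty set is \<open>\<infinity>\<close>.\<close>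

definition divergence :: "real \<Rightarrow> 'a::metric_space \<Rightarrow> 'a \<Rightarrow> 'a \<Rightarrow> real \<Rightarrow> ennreal" where
  "divergence eps a b c \<delta> =
     (INF p\<in>{p. is_path p \<and> seg_start p = a \<and> seg_end p = b \<and>
                \<delta> * infdist c {a, b} - eps \<le> infdist c (seg_image p)}. seg_length p)"

definition Divergence :: "'a::metric_space itself \<Rightarrow> real \<Rightarrow> real \<Rightarrow> real \<Rightarrow> ennreal" where
  "Divergence _ eps n \<delta> =
     (SUP (a, b, c)\<in>{(a::'a, b, c). dist a b \<le> n}. divergence eps a b c \<delta>)"

end

(*
  At each of a and b there is a special path escaping to infinity in both directions. As it is a
  quasi-geodesic, its two halves cannot both come close to c, so one of them leads from a
  (respectively b) to a point a' (respectively b') at distance N = n_j / 2 from c without entering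
  B(c, R), where R is a fixed fraction of r = d(c, {a, b}). By hypothesis a' and b' are joined by a
  path of length O(N) outside B(c, \<delta> N - eps). Cut into pieces of diameter comparable to N and
  replaced piecewise by special paths, it becomes a polygonal line with a number of sides that does
  not depend on j. Thus a and b are joined outside B(c, R) by a polygonal line, possibly
  extremely long, but with a bounded number M of sides. Prolonging it at both ends along special
  paths towards c, up to distance 2 R from c, makes navigability applicable, which replaces it by a
  path of length O(R) outside B(c, R / C0). If d(a, b) \<le> r or r is bounded, a geodesic from a to b
  suffices.
*)
theory Submission
  imports Defs
begin

section \<open>Lengths of curves\<close>

text \<open>Structural recursion replaces the indexed sum in \<open>curve_length\<close>, so that
  partitions can be treated by induction on lists.\<close>

fun chain_length :: "(real \<Rightarrow> 'a::metric_space) \<Rightarrow> real list \<Rightarrow> ennreal" where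
  "chain_length f (s # t # ts) = ennreal (dist (f s) (f t)) + chain_length f (t # ts)"
| "chain_length f _ = 0"

lemma chain_length_eq_sum:
  "chain_length f ts = (\<Sum>i<length ts - 1. ennreal (dist (f (ts ! i)) (f (ts ! Suc i))))"
proof (induction f ts rule: chain_length.induct)
  case (1 f s t ts)
  then show ?case by (simp add: sum.lessThan_Suc_shift del: sum.lessThan_Suc)
qed auto

lemma curve_length_eq_SUP_chain:
  "curve_length a b f = (SUP ts\<in>{ts. sorted ts \<and> set ts \<subseteq> {a..b}}. chain_length f ts)"
  by (simp add: curve_length_def chain_length_eq_sum)

lemma chain_length_le_curve_length:
  assumes "sorted ts" "set ts \<subseteq> {a..b}"
  shows "chain_length f ts \<le> curve_length a b f"
  unfolding curve_length_eq_SUP_chain by (rule SUP_upper) (use assms in auto)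

lemma curve_length_leI:
  assumes "\<And>ts. sorted ts \<Longrightarrow> set ts \<subseteq> {a..b} \<Longrightarrow> chain_length f ts \<le> L"
  shows "curve_length a b f \<le> L"
  unfolding curve_length_eq_SUP_chain by (rule SUP_least) (use assms in auto)

lemma chain_length_cong:
  assumes "\<And>t. t \<in> set ts \<Longrightarrow> f t = g t"
  shows "chain_length f ts = chain_length g ts"
  using assms by (induction f ts rule: chain_length.induct) auto

lemma chain_length_map: "chain_length f (map h ts) = chain_length (f \<circ> h) ts"
  by (induction "f \<circ> h" ts rule: chain_length.induct) auto

text \<open>Inserting \<open>b\<close> cannot shorten a chain, by the triangle inequality. The point
  \<open>b\<close> occurs in both chains on the right so that each can be confined to one half of an
  interval split at \<open>b\<close>.\<close>

lemma chain_length_append_le: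
  "chain_length f (us @ vs) \<le> chain_length f (us @ [b]) + chain_length f (b # vs)"
proof (induction f us rule: chain_length.induct)
  case (1 f s t ts)
  then show ?case by (simp add: add.assoc add_left_mono)
next
  case ("2_1" f)
  show ?case by (cases vs) auto
next
  case ("2_2" f u)
  show ?case
  proof (cases vs)
    case (Cons v vs')
    have "ennreal (dist (f u) (f v)) \<le> ennreal (dist (f u) (f b)) + ennreal (dist (f b) (f v))"
      by (simp flip: ennreal_plus add: dist_triangle)
    then show ?thesis using Cons by (simp add: add.assoc[symmetric] add_right_mono)
  qed auto
qed

lemma curve_length_cong:
  assumes "\<And>t. t \<in> {a..b} \<Longrightarrow> f t = g t"
  shows "curve_length a b f = curve_length a b g"
proof -
  have "chain_length f ts = chain_length g ts" if "set ts \<subseteq> {a..b}" for ts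
    using chain_length_cong[of ts f g] assms that by blast
  then show ?thesis unfolding curve_length_eq_SUP_chain by (intro SUP_cong) auto
qed

lemma curve_length_triangle:
  assumes "a \<le> b" "b \<le> c"
  shows "curve_length a c f \<le> curve_length a b f + curve_length b c f"
proof (rule curve_length_leI)
  fix ts :: "real list"
  assume ts: "sorted ts" "set ts \<subseteq> {a..c}"
  define us where "us = takeWhile (\<lambda>t. t \<le> b) ts"
  define vs where "vs = dropWhile (\<lambda>t. t \<le> b) ts"
  have split: "ts = us @ vs" by (simp add: us_def vs_def)
  have us: "t \<le> b" if "t \<in> set us" for t using that by (auto simp: us_def dest: set_takeWhileD)
  have vs: "b \<le> t" if "t \<in> set vs" for t
  proof (cases vs)
    case (Cons v vs')
    then have "\<not> v \<le> b" unfolding vs_def by (simp add: dropWhile_eq_Cons_conv)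
    moreover have "sorted vs" using ts split by (simp add: sorted_append)
    ultimately show ?thesis using Cons that by auto
  qed (use that in auto)
  have "chain_length f ts \<le> chain_length f (us @ [b]) + chain_length f (b # vs)"
    unfolding split by (rule chain_length_append_le)
  also have "\<dots> \<le> curve_length a b f + curve_length b c f"
    using us vs ts assms unfolding split
    by (intro add_mono chain_length_le_curve_length) (auto simp: sorted_append)
  finally show "chain_length f ts \<le> curve_length a b f + curve_length b c f" .
qed

text \<open>Prefixing \<open>a\<close> and \<open>t\<close> to a partition of \<open>{t..b}\<close>
  gives a partition of \<open>{a..b}\<close>. This is the form of additivity by which a curve is
  used up piece by piece in \<open>polygonal_approximation\<close>.\<close>

lemma dist_plus_curve_length_le:
  assumes "a \<le> t" "t \<le> b"
  shows "ennreal (dist (f a) (f t)) + curve_length t b f \<le> curve_length a b f"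
proof -
  have "ennreal (dist (f a) (f t)) + chain_length f ts \<le> curve_length a b f"
    if ts: "sorted ts" "set ts \<subseteq> {t..b}" for ts
  proof -
    have "chain_length f ts \<le> chain_length f (t # ts)" by (cases ts) auto
    then have "ennreal (dist (f a) (f t)) + chain_length f ts \<le> chain_length f (a # t # ts)"
      by (simp add: add_left_mono)
    also have "\<dots> \<le> curve_length a b f"
      by (rule chain_length_le_curve_length) (use ts assms in auto)
    finally show ?thesis .
  qed
  then have "(SUP ts\<in>{ts. sorted ts \<and> set ts \<subseteq> {t..b}}. ennreal (dist (f a) (f t)) + chain_length f ts)
      \<le> curve_length a b f"
    by (intro SUP_least) auto
  \<comment> \<open>The empty list witnesses that the index set is nonempty, which lets the constant
    move out of the supremum.\<close>
  moreover have "(SUP ts\<in>{ts. sorted ts \<and> set ts \<subseteq> {t..b}}. ennreal (dist (f a) (f t)) + chain_length f ts)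
     = ennreal (dist (f a) (f t)) + curve_length t b f"
    unfolding curve_length_eq_SUP_chain
    by (rule ennreal_SUP_add_right[symmetric]) (auto intro: exI[of _ "[]"])
  ultimately show ?thesis by simp
qed

lemma curve_length_translate:
  "curve_length a b (\<lambda>t. f (t + c)) \<le> curve_length (a + c) (b + c) f"
proof (rule curve_length_leI)
  fix ts :: "real list"
  assume ts: "sorted ts" "set ts \<subseteq> {a..b}"
  have "chain_length (\<lambda>t. f (t + c)) ts = chain_length f (map (\<lambda>t. t + c) ts)"
    by (simp add: chain_length_map o_def)
  also have "\<dots> \<le> curve_length (a + c) (b + c) f"
    by (rule chain_length_le_curve_length) (use ts in \<open>auto simp: sorted_map\<close>)
  finally show "chain_length (\<lambda>t. f (t + c)) ts \<le> curve_length (a + c) (b + c) f" .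
qed

lemma curve_length_geodesic_le:
  assumes geo: "\<And>s t. s \<in> {a..b} \<Longrightarrow> t \<in> {a..b} \<Longrightarrow> dist (f s) (f t) = \<bar>s - t\<bar>"
  shows "curve_length a b f \<le> ennreal (b - a)"
proof (rule curve_length_leI)
  fix ts assume ts: "sorted ts" "set ts \<subseteq> {a..b}"
  \<comment> \<open>The bound refers to the head of the list, so that the sum telescopes in the
    induction; the head is compared with \<open>a\<close> only afterwards.\<close>
  have *: "chain_length f ts \<le> ennreal (b - hd ts)" if "ts \<noteq> []" "sorted ts" "set ts \<subseteq> {a..b}" for ts
    using that geo
  proof (induction f ts rule: chain_length.induct)
    case (1 f s t ts)
    then have "ennreal (dist (f s) (f t)) + chain_length f (t # ts) \<le> ennreal (t - s) + ennreal (b - t)"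
      by (intro add_mono) auto
    also have "\<dots> = ennreal (b - s)" using 1 by (subst ennreal_plus[symmetric]) auto
    finally show ?case by simp
  qed auto
  show "chain_length f ts \<le> ennreal (b - a)"
  proof (cases ts)
    case (Cons t ts')
    then have "a \<le> t" using ts by auto
    then have "ennreal (b - t) \<le> ennreal (b - a)" by (intro ennreal_leI) simp
    moreover have "chain_length f ts \<le> ennreal (b - t)" using *[of ts] ts Cons by simp
    ultimately show ?thesis by (rule order_trans[rotated])
  qed auto
qed

section \<open>Joining two paths\<close>

lemma join_seg_start_end:
  assumes "seg_lo p \<le> seg_hi p" "seg_lo q \<le> seg_hi q" "seg_end p = seg_start q"
  shows "seg_start (join_seg p q) = seg_start p" "seg_end (join_seg p q) = seg_end q"
  using assms by (auto simp: join_seg_def seg_start_def seg_end_def Let_def)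

lemma join_seg_image:
  assumes "seg_lo p \<le> seg_hi p" "seg_lo q \<le> seg_hi q" "seg_end p = seg_start q"
  shows "seg_image (join_seg p q) = seg_image p \<union> seg_image q"
proof
  show "seg_image (join_seg p q) \<subseteq> seg_image p \<union> seg_image q"
    using assms by (auto simp: join_seg_def seg_image_def seg_dom_def Let_def)
  have "seg_fun p t \<in> seg_image (join_seg p q)" if "t \<in> seg_dom p" for t
    using that assms unfolding seg_image_def seg_dom_def
    by (intro image_eqI[of _ _ t]) (auto simp: join_seg_def Let_def)
  moreover have "seg_fun q t \<in> seg_image (join_seg p q)" if "t \<in> seg_dom q" for t
    using that assms unfolding seg_image_def seg_dom_def
    by (intro image_eqI[of _ _ "t - seg_lo q + seg_hi p"])
      (auto simp: join_seg_def Let_def seg_start_def seg_end_def)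
  ultimately show "seg_image p \<union> seg_image q \<subseteq> seg_image (join_seg p q)"
    by (auto simp: seg_image_def[of p] seg_image_def[of q])
qed

lemma is_path_join_seg:
  assumes p: "is_path p" and q: "is_path q" and pq: "seg_end p = seg_start q"
  shows "is_path (join_seg p q)"
proof -
  let ?b = "seg_hi p + (seg_hi q - seg_lo q)"
  let ?g = "\<lambda>t. seg_fun q (t - seg_hi p + seg_lo q)"
  let ?f = "\<lambda>t. if t \<le> seg_hi p then seg_fun p t else ?g t"
  have le: "seg_lo p \<le> seg_hi p" "seg_lo q \<le> seg_hi q"
    and cont: "continuous_on {seg_lo p..seg_hi p} (seg_fun p)"
      "continuous_on {seg_lo q..seg_hi q} (seg_fun q)"
    using p q by (auto simp: is_path_def seg_dom_def)
  have "continuous_on {seg_hi p..?b} ?g"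
    by (rule continuous_on_compose2[OF cont(2)]) (auto intro!: continuous_intros)
  then have "continuous_on ({seg_lo p..seg_hi p} \<union> {seg_hi p..?b}) ?f"
    using cont pq by (intro continuous_on_cases) (auto simp: seg_end_def seg_start_def)
  moreover have "{seg_lo p..seg_hi p} \<union> {seg_hi p..?b} = {seg_lo p..?b}" using le by auto
  ultimately have "continuous_on {seg_lo p..?b} ?f" by simp
  then have "continuous_on {seg_lo p..?b} (restrict ?f {seg_lo p..?b})"
    by (rule continuous_on_cong[THEN iffD1, rotated 2]) auto
  then show ?thesis using le by (simp add: is_path_def join_seg_def seg_dom_def Let_def)
qed

lemma seg_length_join_seg:
  assumes le: "seg_lo p \<le> seg_hi p" "seg_lo q \<le> seg_hi q" and pq: "seg_end p = seg_start q"
  shows "seg_length (join_seg p q) \<le> seg_length p + seg_length q"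
proof -
  let ?b = "seg_hi p + (seg_hi q - seg_lo q)"
  let ?j = "seg_fun (join_seg p q)"
  have "seg_length (join_seg p q) \<le> curve_length (seg_lo p) (seg_hi p) ?j + curve_length (seg_hi p) ?b ?j"
    using curve_length_triangle[of "seg_lo p" "seg_hi p" ?b ?j] le
    by (simp add: seg_length_def join_seg_def Let_def)
  also have "curve_length (seg_lo p) (seg_hi p) ?j = seg_length p"
    unfolding seg_length_def
    by (rule curve_length_cong) (use le in \<open>auto simp: join_seg_def Let_def\<close>)
  \<comment> \<open>At the parameter \<open>seg_hi p\<close> the joined path is defined by
    \<open>p\<close>, so the two functions agree there only thanks to \<open>pq\<close>.\<close>
  also have "curve_length (seg_hi p) ?b ?j
      = curve_length (seg_hi p) ?b (\<lambda>t. seg_fun q (t + (seg_lo q - seg_hi p)))"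
    by (rule curve_length_cong)
      (use le pq in \<open>auto simp: join_seg_def Let_def seg_end_def seg_start_def algebra_simps\<close>)
  also have "\<dots> \<le> seg_length q"
    using curve_length_translate[of "seg_hi p" ?b "seg_fun q" "seg_lo q - seg_hi p"]
    by (simp add: seg_length_def)
  finally show ?thesis by (simp add: add_left_mono)
qed

section \<open>Paths of bounded length inside a set, and divergence\<close>

lemma infdist_geI: "A \<noteq> {} \<Longrightarrow> (\<And>x. x \<in> A \<Longrightarrow> r \<le> dist c x) \<Longrightarrow> r \<le> infdist c A"
  by (simp add: infdist_notempty cINF_greatest)

lemma seg_image_nonempty: "is_path p \<Longrightarrow> seg_image p \<noteq> {}"
  by (auto simp: seg_image_def seg_dom_def is_path_def)

text \<open>Keeping away from \<open>c\<close> is written as containment in a set, which survives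
  joining paths while the length bounds add up.\<close>

definition joined_within :: "'a::metric_space set \<Rightarrow> ennreal \<Rightarrow> 'a \<Rightarrow> 'a \<Rightarrow> bool" where
  "joined_within A L x y \<longleftrightarrow>
     (\<exists>p. is_path p \<and> seg_start p = x \<and> seg_end p = y \<and> seg_image p \<subseteq> A \<and> seg_length p \<le> L)"

lemma joined_within_trans:
  assumes "joined_within A L x y" "joined_within A M y z"
  shows "joined_within A (L + M) x z"
proof -
  obtain p q where p: "is_path p" "seg_start p = x" "seg_end p = y" "seg_image p \<subseteq> A" "seg_length p \<le> L"
    and q: "is_path q" "seg_start q = y" "seg_end q = z" "seg_image q \<subseteq> A" "seg_length q \<le> M"
    using assms unfolding joined_within_def by metis
  have le: "seg_lo p \<le> seg_hi p" "seg_lo q \<le> seg_hi q" using p q by (auto simp: is_path_def)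
  show ?thesis unfolding joined_within_def
  proof (intro exI conjI)
    show "is_path (join_seg p q)" using p q by (simp add: is_path_join_seg)
    show "seg_start (join_seg p q) = x" "seg_end (join_seg p q) = z"
      using join_seg_start_end[OF le] p q by auto
    show "seg_image (join_seg p q) \<subseteq> A" using join_seg_image[OF le] p q by simp
    show "seg_length (join_seg p q) \<le> L + M"
      using seg_length_join_seg[OF le] add_mono[OF p(5) q(5)] p(3) q(2) by (auto intro: order_trans)
  qed
qed

lemma joined_within_mono:
  "joined_within A L x y \<Longrightarrow> A \<subseteq> B \<Longrightarrow> L \<le> M \<Longrightarrow> joined_within B M x y"
  unfolding joined_within_def by (blast intro: order_trans)

lemma divergence_leI:
  assumes "joined_within {x. \<delta> * infdist c {a, b} - eps \<le> dist c x} L a b"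
  shows "divergence eps a b c \<delta> \<le> L"
proof -
  obtain p where p: "is_path p" "seg_start p = a" "seg_end p = b"
    "seg_image p \<subseteq> {x. \<delta> * infdist c {a, b} - eps \<le> dist c x}" "seg_length p \<le> L"
    using assms unfolding joined_within_def by auto
  have "\<delta> * infdist c {a, b} - eps \<le> infdist c (seg_image p)"
    by (rule infdist_geI) (use p seg_image_nonempty in auto)
  then show ?thesis unfolding divergence_def using p by (intro INF_lower2[of p]) auto
qed

text \<open>The infimum need not be attained, so the inequality is strict.\<close>

lemma divergence_lessE:
  assumes "divergence eps a b c \<delta> < L"
  shows "joined_within {x. \<delta> * infdist c {a, b} - eps \<le> dist c x} L a b"
proof -
  obtain p where p: "is_path p" "seg_start p = a" "seg_end p = b"
    "\<delta> * infdist c {a, b} - eps \<le> infdist c (seg_image p)" "seg_length p < L"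
    using assms unfolding divergence_def INF_less_iff by auto
  have "\<delta> * infdist c {a, b} - eps \<le> dist c x" if "x \<in> seg_image p" for x
    using infdist_le[OF that, of c] p(4) by linarith
  then show ?thesis unfolding joined_within_def using p by (intro exI[of _ p]) (auto intro: less_imp_le)
qed

text \<open>Every point of a geodesic gives equality in the triangle inequality; this is all that is
  used to keep the geodesic inside \<open>A\<close>.\<close>

lemma joined_within_geodesic:
  fixes x y :: "'a::metric_space"
  assumes "geodesic_space TYPE('a)"
    and A: "\<And>z. dist x z + dist z y = dist x y \<Longrightarrow> z \<in> A"
  shows "joined_within A (ennreal (dist x y)) x y"
proof -
  obtain g where g: "g 0 = x" "g (dist x y) = y"
    and iso: "\<And>s t. s \<in> {0..dist x y} \<Longrightarrow> t \<in> {0..dist x y} \<Longrightarrow> dist (g s) (g t) = \<bar>s - t\<bar>"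
    using assms(1) unfolding geodesic_space_def by blast
  let ?p = "Segment 0 (dist x y) (restrict g {0..dist x y})"
  have cont: "continuous_on {0..dist x y} g"
    unfolding continuous_on_iff by (metis iso dist_real_def)
  then have "continuous_on {0..dist x y} (restrict g {0..dist x y})"
    by (rule continuous_on_cong[THEN iffD1, rotated 2]) auto
  then have "is_path ?p" by (simp add: is_path_def seg_dom_def)
  moreover have "seg_image ?p \<subseteq> A"
  proof
    fix z assume "z \<in> seg_image ?p"
    then obtain t where t: "t \<in> {0..dist x y}" "z = g t" by (auto simp: seg_image_def seg_dom_def)
    show "z \<in> A" using iso[of 0 t] iso[of t "dist x y"] t g by (intro A) auto
  qed
  moreover have "seg_length ?p \<le> ennreal (dist x y - 0)"
    unfolding seg_length_def by (simp only: segment.sel, rule curve_length_geodesic_le) (use iso in auto)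
  ultimately show ?thesis unfolding joined_within_def using g
    by (intro exI[of _ ?p]) (auto simp: seg_start_def seg_end_def)
qed

section \<open>Special paths and polygonal lines\<close>

lemma concatenation_is_path:
  assumes "concatenation hs p" "\<forall>h\<in>set hs. is_path h"
  shows "is_path p"
  using assms by induction (auto simp: is_path_join_seg)

text \<open>\<open>concatenation\<close> nests joins to the right, so \<open>r\<close> is rebuilt
  side by side along the induction. Of \<open>r\<close> only the endpoints and the image are
  recorded.\<close>

lemma concatenation_append:
  assumes "concatenation hs p" "concatenation gs q"
    and "\<forall>h\<in>set hs. is_path h" "\<forall>g\<in>set gs. is_path g" "seg_end p = seg_start q"
  shows "\<exists>r. concatenation (hs @ gs) r \<and> seg_start r = seg_start p \<and> seg_end r = seg_end q \<and>
             seg_image r = seg_image p \<union> seg_image q"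
  using assms
proof induction
  case (single h)
  then have "seg_lo h \<le> seg_hi h" "seg_lo q \<le> seg_hi q"
    using concatenation_is_path[of gs q] by (auto simp: is_path_def)
  then show ?case
    using single concatenation.join[of gs q h] join_seg_start_end[of h q] join_seg_image[of h q]
    by (intro exI[of _ "join_seg h q"]) simp
next
  case (join hs p h)
  have "is_path p" using join concatenation_is_path by auto
  then have le: "seg_lo h \<le> seg_hi h" "seg_lo p \<le> seg_hi p" using join by (auto simp: is_path_def)
  note hp = join_seg_start_end[OF le join.hyps(2)] join_seg_image[OF le join.hyps(2)]
  obtain r where r: "concatenation (hs @ gs) r" "seg_start r = seg_start p" "seg_end r = seg_end q"
    "seg_image r = seg_image p \<union> seg_image q"
    using join.IH join.prems hp by auto
  have hr: "seg_end h = seg_start r" using r join.hyps by simp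
  have "is_path r" using concatenation_is_path[OF r(1)] join.prems by auto
  then have le': "seg_lo r \<le> seg_hi r" by (auto simp: is_path_def)
  show ?case
    using r hp concatenation.join[OF r(1) hr] join_seg_start_end[OF le(1) le' hr]
      join_seg_image[OF le(1) le' hr]
    by (intro exI[of _ "join_seg h r"]) auto
qed

locale special_paths =
  fixes P :: "'a::metric_space segment set" and lam kap :: real
  assumes system: "path_system lam kap P" and undirected: "undirected P"
begin

lemma special_is_path: "h \<in> P \<Longrightarrow> is_path h"
  and special_quasi_geodesic: "h \<in> P \<Longrightarrow> quasi_geodesic lam kap (seg_dom h) (seg_fun h)"
  and special_subseg: "h \<in> P \<Longrightarrow> seg_lo h \<le> c \<Longrightarrow> c \<le> d \<Longrightarrow> d \<le> seg_hi h \<Longrightarrow> subseg h c d \<in> P"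
  and special_exists: "\<exists>h\<in>P. seg_start h = x \<and> seg_end h = y"
  and special_reverse: "h \<in> P \<Longrightarrow> reverse_seg h \<in> P"
  using system undirected unfolding path_system_def undirected_def by blast+

lemma special_le: "h \<in> P \<Longrightarrow> seg_lo h \<le> seg_hi h"
  using special_is_path by (auto simp: is_path_def)

lemma lam_kap: "1 \<le> lam" "0 \<le> kap"
  using special_exists special_quasi_geodesic unfolding quasi_geodesic_def by blast+

text \<open>A bound for the distance of the points of a special path from its start, in terms of the
  distance \<open>s\<close> of its endpoints.\<close>

definition spread :: "real \<Rightarrow> real" where
  "spread s = lam * (lam * (s + kap)) + kap"

lemma spread_mono: "s \<le> t \<Longrightarrow> spread s \<le> spread t"
  using lam_kap by (simp add: spread_def mult_left_mono)

text \<open>The lower quasi-geodesic inequality bounds \<open>|r - t|\<close>, hence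
  \<open>|r - s|\<close>, and the upper one turns this back into a distance.\<close>

lemma dist_special_le_spread:
  assumes h: "h \<in> P" and t: "r \<in> seg_dom h" "t \<in> seg_dom h" "s \<in> {min r t..max r t}"
  shows "dist (seg_fun h r) (seg_fun h s) \<le> spread (dist (seg_fun h r) (seg_fun h t))"
proof -
  let ?d = "\<lambda>r s. dist (seg_fun h r) (seg_fun h s)"
  have s: "s \<in> seg_dom h" using t by (auto simp: seg_dom_def)
  have qg: "\<bar>r - s\<bar> / lam - kap \<le> ?d r s \<and> ?d r s \<le> lam * \<bar>r - s\<bar> + kap"
    if "r \<in> seg_dom h" "s \<in> seg_dom h" for r s
    using special_quasi_geodesic[OF h] that unfolding quasi_geodesic_def by blast
  have "\<bar>r - t\<bar> \<le> lam * (?d r t + kap)"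
    using qg[OF t(1,2)] lam_kap by (simp add: field_simps)
  moreover have "\<bar>r - s\<bar> \<le> \<bar>r - t\<bar>" using t(3) by auto
  ultimately have "lam * \<bar>r - s\<bar> \<le> lam * (lam * (?d r t + kap))"
    using lam_kap by (intro mult_left_mono) auto
  then show ?thesis using qg[OF t(1) s] unfolding spread_def by linarith
qed

lemma special_image_spread:
  assumes "h \<in> P" "z \<in> seg_image h"
  shows "dist (seg_start h) z \<le> spread (dist (seg_start h) (seg_end h))"
proof -
  obtain s where "s \<in> seg_dom h" "z = seg_fun h s" using assms(2) by (auto simp: seg_image_def)
  then show ?thesis
    using dist_special_le_spread[OF assms(1), of "seg_lo h" "seg_hi h" s] special_le[OF assms(1)]
    by (auto simp: seg_start_def seg_end_def seg_dom_def)
qed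

text \<open>\<open>linear_const\<close> and \<open>additive_const\<close> are the constants k1 and
  k2 of the convention that quasi-geodesics are improved.\<close>

definition linear_const :: real where
  "linear_const = lam * (lam + kap)"

definition additive_const :: real where
  "additive_const = (lam * (2 * (lam + kap)) + 3) * (lam + kap)"

lemma special_length_le:
  assumes "h \<in> P"
  shows "seg_length h \<le> ennreal (linear_const * dist (seg_start h) (seg_end h) + additive_const)"
proof -
  have "curve_length t t' (seg_fun h)
      \<le> ennreal (linear_const * dist (seg_fun h t) (seg_fun h t') + additive_const)"
    if "t \<in> seg_dom h" "t' \<in> seg_dom h" "t \<le> t'" for t t'
    using special_quasi_geodesic[OF assms] that
    unfolding quasi_geodesic_def Let_def linear_const_def additive_const_def by blast
  then show ?thesis
    using special_le[OF assms] by (simp add: seg_length_def seg_start_def seg_end_def seg_dom_def)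
qed

lemma const_nonneg: "0 \<le> linear_const" "0 \<le> additive_const"
  using lam_kap by (auto simp: linear_const_def additive_const_def)

text \<open>Only the number of sides is controlled, not the length: navigability bounds the length
  of the new path by the number of sides of the old one and the radius alone.\<close>

definition polygonally_joined :: "nat \<Rightarrow> 'a set \<Rightarrow> 'a \<Rightarrow> 'a \<Rightarrow> bool" where
  "polygonally_joined n A x y \<longleftrightarrow>
     (\<exists>p. polygonal_line n P p \<and> seg_start p = x \<and> seg_end p = y \<and> seg_image p \<subseteq> A)"

lemma polygonal_line_is_path: "polygonal_line n P p \<Longrightarrow> is_path p"
  unfolding polygonal_line_def using concatenation_is_path special_is_path by blast

lemma polygonally_joined_trans:
  assumes "polygonally_joined m A x y" "polygonally_joined n A y z"
  shows "polygonally_joined (m + n) A x z"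
proof -
  obtain p hs where p: "length hs \<le> m" "set hs \<subseteq> P" "concatenation hs p"
    "seg_start p = x" "seg_end p = y" "seg_image p \<subseteq> A"
    using assms(1) unfolding polygonally_joined_def polygonal_line_def by blast
  obtain q gs where q: "length gs \<le> n" "set gs \<subseteq> P" "concatenation gs q"
    "seg_start q = y" "seg_end q = z" "seg_image q \<subseteq> A"
    using assms(2) unfolding polygonally_joined_def polygonal_line_def by blast
  obtain r where "concatenation (hs @ gs) r" "seg_start r = seg_start p" "seg_end r = seg_end q"
    "seg_image r = seg_image p \<union> seg_image q"
    using concatenation_append[OF p(3) q(3)] p q special_is_path by (metis subsetD)
  then show ?thesis unfolding polygonally_joined_def polygonal_line_def
    using p q by (intro exI[of _ r] conjI exI[of _ "hs @ gs"]) auto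
qed

lemma polygonally_joined_special:
  assumes "h \<in> P" "seg_image h \<subseteq> A"
  shows "polygonally_joined 1 A (seg_start h) (seg_end h)"
  unfolding polygonally_joined_def polygonal_line_def
  using assms by (intro exI[of _ h] conjI exI[of _ "[h]"]) (auto intro: concatenation.single)

lemma polygonally_joined_mono:
  "polygonally_joined n A x y \<Longrightarrow> A \<subseteq> B \<Longrightarrow> n \<le> m \<Longrightarrow> polygonally_joined m B x y"
  unfolding polygonally_joined_def polygonal_line_def by (blast intro: order_trans)

lemma reverse_seg_simps:
  assumes "h \<in> P"
  shows "seg_start (reverse_seg h) = seg_end h" "seg_end (reverse_seg h) = seg_start h"
    "seg_image (reverse_seg h) \<subseteq> seg_image h"
  using special_le[OF assms]
  by (auto simp: reverse_seg_def seg_start_def seg_end_def seg_image_def seg_dom_def)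

text \<open>The sides are reversed one at a time and reassembled in the opposite order; a reversed
  side is special because the system is undirected.\<close>

lemma polygonally_joined_sym:
  assumes "polygonally_joined n A x y"
  shows "polygonally_joined n A y x"
proof -
  have "polygonally_joined (length hs) (seg_image p) (seg_end p) (seg_start p)"
    if "concatenation hs p" "set hs \<subseteq> P" for hs p
    using that
  proof induction
    case (single h)
    then show ?case
      using polygonally_joined_special[of "reverse_seg h"] special_reverse reverse_seg_simps by auto
  next
    case (join hs p h)
    then have "seg_lo h \<le> seg_hi h" "seg_lo p \<le> seg_hi p" "h \<in> P"
      using concatenation_is_path[of hs p] special_is_path by (auto simp: is_path_def)
    note hp = join_seg_start_end[OF this(1,2) join.hyps(2)] join_seg_image[OF this(1,2) join.hyps(2)]
    have "polygonally_joined 1 (seg_image (join_seg h p)) (seg_end h) (seg_start h)"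
      using polygonally_joined_special[of "reverse_seg h" "seg_image (join_seg h p)"]
        special_reverse[OF \<open>h \<in> P\<close>] reverse_seg_simps[OF \<open>h \<in> P\<close>] hp by auto
    moreover have "polygonally_joined (length hs) (seg_image (join_seg h p)) (seg_end p) (seg_end h)"
      using join polygonally_joined_mono[of "length hs" "seg_image p"] hp by auto
    ultimately show ?case
      using polygonally_joined_trans[of "length hs" _ "seg_end p" "seg_end h" 1 "seg_start h"] hp by simp
  qed
  then show ?thesis
    using assms unfolding polygonally_joined_def[of n A x] polygonal_line_def
    by (auto intro: polygonally_joined_mono)
qed

lemma polygonally_joined_close:
  assumes "\<And>z. dist x z \<le> spread (dist x y) \<Longrightarrow> z \<in> A"
  shows "polygonally_joined 1 A x y"
proof -
  obtain h where h: "h \<in> P" "seg_start h = x" "seg_end h = y" using special_exists by blast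
  then have "seg_image h \<subseteq> A" using assms special_image_spread[OF h(1)] by blast
  then show ?thesis using polygonally_joined_special[OF h(1)] h by blast
qed

lemma polygonally_joined_subseg:
  assumes h: "h \<in> P" and st: "seg_lo h \<le> s" "s \<le> t" "t \<le> seg_hi h"
    and A: "\<And>u. s \<le> u \<Longrightarrow> u \<le> t \<Longrightarrow> seg_fun h u \<in> A"
  shows "polygonally_joined 1 A (seg_fun h s) (seg_fun h t)"
proof -
  have "seg_image (subseg h s t) \<subseteq> A" using A by (auto simp: seg_image_def subseg_def seg_dom_def)
  then show ?thesis
    using polygonally_joined_special[OF special_subseg[OF h st], of A] st
    by (simp add: subseg_def seg_start_def seg_end_def)
qed

section \<open>Polygonal approximation of curves, and special paths leading away from or towards a
  point\<close>

lemma special_continuous: "h \<in> P \<Longrightarrow> continuous_on {seg_lo h..seg_hi h} (seg_fun h)"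
  using special_is_path by (auto simp: is_path_def seg_dom_def)

text \<open>Greedy subdivision: while \<open>f b\<close> is farther than \<open>s\<close> from
  \<open>f a\<close>, the curve is cut at a point at distance exactly \<open>s\<close> from its
  start. Each cut uses up at least \<open>s\<close> of the length, so \<open>q\<close> cuts and
  \<open>Suc q\<close> sides suffice.\<close>

lemma polygonal_approximation:
  assumes "continuous_on {a..b} f" "a \<le> b" "0 \<le> s" "curve_length a b f \<le> ennreal (real q * s)"
    and A: "\<And>t z. t \<in> {a..b} \<Longrightarrow> dist (f t) z \<le> spread s \<Longrightarrow> z \<in> A"
  shows "polygonally_joined (Suc q) A (f a) (f b)"
proof -
  \<comment> \<open>This is stated for every left end \<open>a\<close> because the induction below
    moves it.\<close>
  have close: "polygonally_joined 1 A (f t) y"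
    if "dist (f t) y \<le> s" "t \<in> {a..b}"
      "\<And>t z. t \<in> {a..b} \<Longrightarrow> dist (f t) z \<le> spread s \<Longrightarrow> z \<in> A" for t y a
  proof (rule polygonally_joined_close)
    fix z assume "dist (f t) z \<le> spread (dist (f t) y)"
    then have "dist (f t) z \<le> spread s" using spread_mono[OF that(1)] by linarith
    then show "z \<in> A" using that by blast
  qed
  show ?thesis
    using assms
  proof (induction q arbitrary: a)
    case 0
    then have "ennreal (dist (f a) (f b)) = 0"
      using dist_plus_curve_length_le[of a b b f] by (auto simp: le_iff_add)
    then have "dist (f a) (f b) \<le> s" using 0 by simp
    then have "polygonally_joined 1 A (f a) (f b)" using 0 by (intro close) auto
    then show ?case by simp
  next
    case (Suc q)
    show ?case
    proof (cases "dist (f a) (f b) \<le> s")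
      case True
      then have "polygonally_joined 1 A (f a) (f b)" using Suc.prems by (intro close) auto
      then show ?thesis by (rule polygonally_joined_mono) auto
    next
      case False
      have "continuous_on {a..b} (\<lambda>t. dist (f a) (f t))"
        using Suc.prems by (intro continuous_intros)
      \<comment> \<open>Any such \<open>t\<close> will do: the curve between \<open>a\<close> and
        \<open>t\<close> is discarded and replaced by a special path, which stays within
        \<open>spread s\<close> of \<open>f a\<close>.\<close>
      then obtain t where t: "a \<le> t" "t \<le> b" "dist (f a) (f t) = s"
        using IVT'[of "\<lambda>t. dist (f a) (f t)" a s b] False Suc.prems by auto
      have "ennreal s + curve_length t b f \<le> ennreal (real (Suc q) * s)"
        using dist_plus_curve_length_le[OF t(1,2), of f] Suc.prems t by simp
      also have "\<dots> = ennreal s + ennreal (real q * s)"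
        using Suc.prems by (simp flip: ennreal_plus add: algebra_simps)
      finally have "curve_length t b f \<le> ennreal (real q * s)"
        by (simp add: ennreal_add_left_cancel_le)
      moreover have "continuous_on {t..b} f"
        using Suc.prems t by (intro continuous_on_subset[OF Suc.prems(1)]) auto
      moreover have "z \<in> A" if "u \<in> {t..b}" "dist (f u) z \<le> spread s" for u z
        using Suc.prems(5)[of u z] that t by simp
      ultimately have "polygonally_joined (Suc q) A (f t) (f b)"
        using Suc.prems(3) t by (intro Suc.IH) blast+
      moreover have "polygonally_joined 1 A (f a) (f t)"
        using Suc.prems t by (intro close) auto
      ultimately show ?thesis using polygonally_joined_trans[of 1 A "f a" "f t" "Suc q"] by simp
    qed
  qed
qed

lemma joined_within_imp_polygonally_joined:
  assumes "joined_within B (ennreal (real q * s)) x y" "0 \<le> s"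
    and "\<And>w z. w \<in> B \<Longrightarrow> dist w z \<le> spread s \<Longrightarrow> z \<in> A"
  shows "polygonally_joined (Suc q) A x y"
proof -
  obtain p where p: "is_path p" "seg_start p = x" "seg_end p = y" "seg_image p \<subseteq> B"
    "seg_length p \<le> ennreal (real q * s)"
    using assms(1) unfolding joined_within_def by blast
  then have "polygonally_joined (Suc q) A (seg_fun p (seg_lo p)) (seg_fun p (seg_hi p))"
  proof (intro polygonal_approximation[where s = s])
    fix t z assume "t \<in> {seg_lo p..seg_hi p}" "dist (seg_fun p t) z \<le> spread s"
    moreover have "seg_fun p t \<in> B"
      using p(4) \<open>t \<in> {seg_lo p..seg_hi p}\<close> by (auto simp: seg_image_def seg_dom_def)
    ultimately show "z \<in> A" using assms(3) by blast
  qed (use p assms in \<open>auto simp: is_path_def seg_dom_def seg_length_def\<close>)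
  then show ?thesis using p by (simp add: seg_start_def seg_end_def)
qed

text \<open>If both halves met the ball, the subpath between the two points, which passes near \<open>a\<close>,
  would have close endpoints and hence stay near \<open>c\<close>.\<close>

lemma escape:
  assumes h: "h \<in> P" "x \<in> seg_image h" and xa: "dist a x \<le> kap"
    and far: "N \<le> dist c (seg_start h)" "N \<le> dist c (seg_end h)"
    and ca: "dist c a + kap \<le> N" "kap + spread (2 * R) + R < dist c a"
      "R + spread kap \<le> dist c a"
  shows "\<exists>a'. dist c a' = N \<and> polygonally_joined 2 {z. R \<le> dist c z} a a'"
proof -
  let ?f = "seg_fun h" and ?A = "{z. R \<le> dist c z}"
  obtain t where t: "seg_lo h \<le> t" "t \<le> seg_hi h" "x = ?f t"
    using h(2) by (auto simp: seg_image_def seg_dom_def)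
  have cont: "continuous_on {seg_lo h..seg_hi h} (\<lambda>u. dist c (?f u))"
    using special_continuous[OF h(1)] by (intro continuous_intros)
  have cx: "dist c x \<le> N" using ca(1) xa dist_triangle[of c x a] by linarith
  \<comment> \<open>The half of \<open>h\<close> after \<open>t\<close> is used if it avoids the
    ball, and otherwise the half before \<open>t\<close>. In either case the path is stopped where
    it is at distance \<open>N\<close> from \<open>c\<close>.\<close>
  have "\<exists>a'. dist c a' = N \<and> polygonally_joined 1 ?A x a'"
  proof (cases "\<forall>u. t \<le> u \<and> u \<le> seg_hi h \<longrightarrow> R \<le> dist c (?f u)")
    case True
    have "\<exists>u\<ge>t. u \<le> seg_hi h \<and> dist c (?f u) = N"
      by (rule IVT') (use cx far t in \<open>auto simp: seg_end_def intro: continuous_on_subset[OF cont]\<close>)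
    then obtain u where u: "t \<le> u" "u \<le> seg_hi h" "dist c (?f u) = N" by blast
    then show ?thesis
      using polygonally_joined_subseg[OF h(1) t(1) u(1,2), of ?A] True t by auto
  next
    case False
    then obtain v where v: "t \<le> v" "v \<le> seg_hi h" "dist c (?f v) < R" by force
    have away: "R \<le> dist c (?f u)" if u: "seg_lo h \<le> u" "u \<le> t" for u
    proof (rule ccontr)
      assume "\<not> R \<le> dist c (?f u)"
      then have uR: "dist c (?f u) < R" by simp
      then have "dist (?f u) (?f v) \<le> 2 * R"
        using v(3) dist_triangle3[of "?f u" "?f v" c] by linarith
      then have "dist (?f u) x \<le> spread (2 * R)"
        using dist_special_le_spread[OF h(1), of u v t] spread_mono[of "dist (?f u) (?f v)" "2 * R"] u v t
        by (auto simp: seg_dom_def)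
      then have "dist c a < kap + spread (2 * R) + R"
        using uR xa dist_triangle[of c a "?f u"] dist_triangle2[of "?f u" a x] by linarith
      then show False using ca by simp
    qed
    have "\<exists>u\<ge>seg_lo h. u \<le> t \<and> dist c (?f u) = N"
      by (rule IVT2') (use cx far t in \<open>auto simp: seg_start_def intro: continuous_on_subset[OF cont]\<close>)
    then obtain u where u: "seg_lo h \<le> u" "u \<le> t" "dist c (?f u) = N" by blast
    then show ?thesis
      using polygonally_joined_subseg[OF h(1) u(1,2) t(2), of ?A] away t
      by (auto intro: polygonally_joined_sym)
  qed
  \<comment> \<open>The point \<open>a\<close> need not lie on \<open>h\<close>; a special path to
    the nearby \<open>x\<close> costs one more side.\<close>
  moreover have "polygonally_joined 1 ?A a x"
  proof (rule polygonally_joined_close)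
    fix z assume "dist a z \<le> spread (dist a x)"
    then have "dist a z \<le> spread kap" using spread_mono[OF xa] by linarith
    then show "z \<in> ?A" using ca(3) dist_triangle[of c a z] by (simp add: dist_commute)
  qed
  ultimately show ?thesis using polygonally_joined_trans[of 1 ?A a x 1] by (auto simp: numeral_2_eq_2)
qed

text \<open>A special path from \<open>a\<close> to \<open>c\<close> is stopped when it first
  reaches distance \<open>\<rho>\<close> from \<open>c\<close>. The same piece serves twice: as a
  side that prolongs a polygonal line, and as a path whose length is bounded by the distance of its
  endpoints.\<close>

lemma approach:
  assumes far: "\<rho> \<le> dist c a" and \<rho>: "0 \<le> \<rho>"
  shows "\<exists>a'. dist c a' = \<rho> \<and> polygonally_joined 1 {z. \<rho> \<le> dist c z} a a' \<and>
      joined_within {z. \<rho> \<le> dist c z} (ennreal (linear_const * dist a a' + additive_const)) a a' \<and>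
      joined_within {z. \<rho> \<le> dist c z} (ennreal (linear_const * dist a a' + additive_const)) a' a"
proof -
  obtain h where h: "h \<in> P" "seg_start h = a" "seg_end h = c" using special_exists by blast
  let ?f = "seg_fun h" and ?A = "{z. \<rho> \<le> dist c z}"
  let ?T = "{t \<in> {seg_lo h..seg_hi h}. dist c (?f t) = \<rho>}"
  have cont: "continuous_on {seg_lo h..seg_hi h} (\<lambda>u. dist c (?f u))"
    using special_continuous[OF h(1)] by (intro continuous_intros)
  have "\<exists>u\<ge>seg_lo h. u \<le> seg_hi h \<and> dist c (?f u) = \<rho>"
    by (rule IVT2') (use far \<rho> h special_le cont in \<open>auto simp: seg_start_def seg_end_def\<close>)
  then have "?T \<noteq> {}" by auto
  moreover have "compact ?T"
    using continuous_closed_preimage_constant[OF cont, of \<rho>]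
    by (auto simp: compact_eq_bounded_closed intro: bounded_subset[of "{seg_lo h..seg_hi h}"])
  ultimately obtain t where t: "t \<in> ?T" and least: "\<And>u. u \<in> ?T \<Longrightarrow> t \<le> u"
    using compact_attains_inf[of ?T] by blast
  have above: "\<rho> \<le> dist c (?f u)" if u: "seg_lo h \<le> u" "u \<le> t" for u
  proof (rule ccontr)
    assume "\<not> \<rho> \<le> dist c (?f u)"
    then have below: "dist c (?f u) < \<rho>" by simp
    \<comment> \<open>Being below \<open>\<rho>\<close> at \<open>u\<close> forces a crossing at
      some \<open>v\<close> before \<open>u\<close>. Since \<open>t\<close> is the first crossing,
      \<open>v = u\<close>, where the distance is not \<open>\<rho>\<close>.\<close>
    have "continuous_on {seg_lo h..u} (\<lambda>v. dist c (?f v))"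
      using u t by (intro continuous_on_subset[OF cont]) auto
    then have "\<exists>v\<ge>seg_lo h. v \<le> u \<and> dist c (?f v) = \<rho>"
      by (intro IVT2') (use below u far h in \<open>auto simp: seg_start_def\<close>)
    then obtain v where v: "seg_lo h \<le> v" "v \<le> u" "dist c (?f v) = \<rho>" by blast
    then have "t \<le> v" using least[of v] u t by auto
    then have "v = u" using v u by simp
    then show False using v below by simp
  qed
  let ?g = "subseg h (seg_lo h) t"
  have g: "?g \<in> P" using special_subseg[OF h(1)] t by auto
  have ends: "seg_start ?g = a" "seg_end ?g = ?f t" using h t
    by (auto simp: subseg_def seg_start_def seg_end_def)
  have img: "seg_image ?g \<subseteq> ?A" using above by (auto simp: subseg_def seg_image_def seg_dom_def)
  note rev = special_reverse[OF g] reverse_seg_simps[OF g]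
  show ?thesis
  proof (intro exI[of _ "?f t"] conjI)
    show "dist c (?f t) = \<rho>" using t by simp
    show "polygonally_joined 1 ?A a (?f t)" using polygonally_joined_special[OF g img] ends by simp
    show "joined_within ?A (ennreal (linear_const * dist a (?f t) + additive_const)) a (?f t)"
      unfolding joined_within_def using special_length_le[OF g] special_is_path[OF g] ends img by auto
    show "joined_within ?A (ennreal (linear_const * dist a (?f t) + additive_const)) (?f t) a"
      unfolding joined_within_def
      using special_length_le[OF rev(1)] special_is_path[OF rev(1)] ends img rev
      by (intro exI[of _ "reverse_seg ?g"]) (auto simp: dist_commute)
  qed
qed

section \<open>Detours with a uniformly bounded number of sides, and the linear bound for
  divergence\<close>

lemma spread_affine: "spread s = lam\<^sup>2 * s + (lam\<^sup>2 * kap + kap)"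
  by (simp add: spread_def power2_eq_square algebra_simps)

text \<open>The bound \<open>M\<close> precedes \<open>a\<close>, \<open>b\<close>, \<open>c\<close>
  and \<open>R\<close>: the length of the path given by the hypothesis and the size of the pieces
  are both proportional to \<open>nj j\<close>, so their ratio is independent of \<open>j\<close>,
  while \<open>j\<close> itself may depend on everything else.\<close>

lemma polygonal_detour:
  fixes nj :: "nat \<Rightarrow> real"
  assumes through: "\<forall>x. \<exists>h :: nat \<Rightarrow> 'a segment.
         (\<forall>j. h j \<in> P \<and> seg_image (h j) \<inter> cball x kap \<noteq> {}) \<and>
         filterlim (\<lambda>j. dist x (seg_start (h j))) at_top sequentially \<and>
         filterlim (\<lambda>j. dist x (seg_end (h j))) at_top sequentially"
    and pos: "0 < \<delta>" "0 < C"
    and nj: "filterlim nj at_top sequentially"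
    and linear: "\<forall>j. Divergence TYPE('a) eps (nj j) \<delta> \<le> ennreal (C * nj j)"
  shows "\<exists>M. \<forall>a b c R.
           (\<forall>x\<in>{a, b}. kap + spread (2 * R) + R < dist c x \<and> R + spread kap \<le> dist c x) \<longrightarrow>
           polygonally_joined M {z. R \<le> dist c z} a b"
proof -
  \<comment> \<open>Special paths between points at distance at most \<open>\<eta> * N\<close>
    deviate by at most \<open>\<delta> * N / 2\<close> plus a constant, which costs only half of the
    clearance \<open>\<delta> * N\<close>.\<close>
  define \<eta> where "\<eta> = \<delta> / (2 * lam\<^sup>2)"
  \<comment> \<open>Pieces of size \<open>\<eta> * N\<close> are to exhaust the length
    \<open>(C + 1) * nj j\<close>, where \<open>nj j = 2 * N\<close>.\<close>
  define q where "q = nat \<lceil>2 * (C + 1) / \<eta>\<rceil>"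
  have \<eta>: "0 < \<eta>" "lam\<^sup>2 * \<eta> = \<delta> / 2" using pos lam_kap by (auto simp: \<eta>_def)
  have "2 * (C + 1) / \<eta> \<le> real q" unfolding q_def by (rule real_nat_ceiling_ge)
  then have q: "2 * (C + 1) \<le> real q * \<eta>" using \<eta> by (simp add: field_simps)
  have "polygonally_joined (2 + (Suc q + 2)) {z. R \<le> dist c z} a b"
    if far: "\<forall>x\<in>{a, b}. kap + spread (2 * R) + R < dist c x \<and> R + spread kap \<le> dist c x" for a b c R
  proof -
    let ?A = "{z. R \<le> dist c z}"
    \<comment> \<open>For \<open>N\<close> at least \<open>B\<close>, the other half of the
      clearance covers \<open>R\<close>, \<open>eps\<close> and the additive part of
      \<open>spread\<close>.\<close>
    define B where "B = 2 * (R + eps + (lam\<^sup>2 * kap + kap)) / \<delta>"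
    have "\<forall>\<^sub>F j in sequentially. 2 * Max {dist c a + kap, dist c b + kap, B, 1} \<le> nj j"
      using nj by (simp add: filterlim_at_top)
    then obtain j where "2 * Max {dist c a + kap, dist c b + kap, B, 1} \<le> nj j"
      by (auto simp: eventually_sequentially)
    \<comment> \<open>With this choice, two points at distance \<open>N\<close> from
      \<open>c\<close> are at distance at most \<open>nj j\<close> from each other.\<close>
    moreover define N where "N = nj j / 2"
    ultimately have N: "dist c a + kap \<le> N" "dist c b + kap \<le> N" "B \<le> N" "1 \<le> N"
      by (simp_all add: max_def split: if_splits)
    have esc: "\<exists>x'. dist c x' = N \<and> polygonally_joined 2 ?A x x'" if x: "x \<in> {a, b}" for x
    proof -
      obtain h :: "nat \<Rightarrow> 'a segment" where h: "\<And>i. h i \<in> P" "\<And>i. seg_image (h i) \<inter> cball x kap \<noteq> {}"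
        and "filterlim (\<lambda>i. dist x (seg_start (h i))) at_top sequentially"
          "filterlim (\<lambda>i. dist x (seg_end (h i))) at_top sequentially"
        using through by metis
      then have "\<forall>\<^sub>F i in sequentially. N + dist c x \<le> dist x (seg_start (h i)) \<and>
          N + dist c x \<le> dist x (seg_end (h i))"
        by (auto simp: filterlim_at_top intro: eventually_conj)
      then obtain i where i: "N + dist c x \<le> dist x (seg_start (h i))" "N + dist c x \<le> dist x (seg_end (h i))"
        by (auto simp: eventually_sequentially)
      obtain y where y: "y \<in> seg_image (h i)" "dist x y \<le> kap" using h(2)[of i] by auto
      show ?thesis
      proof (rule escape[OF h(1) y])
        show "N \<le> dist c (seg_start (h i))" "N \<le> dist c (seg_end (h i))"
          using i dist_triangle3[of x "seg_start (h i)" c] dist_triangle3[of x "seg_end (h i)" c]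
          by linarith+
      qed (use far N x in auto)
    qed
    obtain a' where a': "dist c a' = N" "polygonally_joined 2 ?A a a'" using esc by blast
    obtain b' where b': "dist c b' = N" "polygonally_joined 2 ?A b b'" using esc by blast
    have "dist a' b' \<le> nj j" using a' b' dist_triangle3[of a' b' c] by (simp add: N_def)
    then have "divergence eps a' b' c \<delta> \<le> Divergence TYPE('a) eps (nj j) \<delta>"
      unfolding Divergence_def by (intro SUP_upper2[of "(a', b', c)"]) auto
    also have "\<dots> \<le> ennreal (C * nj j)" using linear by blast
    \<comment> \<open>The larger constant provides the strict inequality from which an actual path
      is obtained.\<close>
    also have "\<dots> < ennreal ((C + 1) * nj j)"
      using N pos by (intro ennreal_lessI) (auto simp: N_def)
    finally have "joined_within {w. \<delta> * infdist c {a', b'} - eps \<le> dist c w} (ennreal ((C + 1) * nj j)) a' b'"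
      by (rule divergence_lessE)
    then have "joined_within {w. \<delta> * N - eps \<le> dist c w} (ennreal (real q * (\<eta> * N))) a' b'"
    proof (rule joined_within_mono)
      have "N \<le> infdist c {a', b'}" by (rule infdist_geI) (use a' b' in auto)
      then have "\<delta> * N \<le> \<delta> * infdist c {a', b'}" using pos by simp
      then show "{w. \<delta> * infdist c {a', b'} - eps \<le> dist c w} \<subseteq> {w. \<delta> * N - eps \<le> dist c w}"
        by auto
      have "2 * (C + 1) * N \<le> real q * \<eta> * N" using q N by (intro mult_right_mono) auto
      then show "ennreal ((C + 1) * nj j) \<le> ennreal (real q * (\<eta> * N))"
        by (intro ennreal_leI) (simp add: N_def algebra_simps)
    qed
    then have mid: "polygonally_joined (Suc q) ?A a' b'"
    proof (rule joined_within_imp_polygonally_joined)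
      show "0 \<le> \<eta> * N" using \<eta> N by simp
      fix w z assume w: "w \<in> {w. \<delta> * N - eps \<le> dist c w}" and z: "dist w z \<le> spread (\<eta> * N)"
      have "spread (\<eta> * N) = \<delta> / 2 * N + (lam\<^sup>2 * kap + kap)"
        unfolding spread_affine using \<eta>(2) by (simp flip: mult.assoc)
      moreover have "R + eps + (lam\<^sup>2 * kap + kap) \<le> \<delta> / 2 * N"
        using N(3) pos unfolding B_def by (simp add: field_simps)
      ultimately have "R \<le> dist c z"
        using w z dist_triangle2[of c w z] dist_triangle[of c w z] by (simp add: dist_commute)
      then show "z \<in> ?A" by simp
    qed
    show ?thesis
      using polygonally_joined_trans[OF a'(2) polygonally_joined_trans[OF mid polygonally_joined_sym[OF b'(2)]]] .
  qed
  then show ?thesis by blast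
qed

text \<open>With \<open>r = K * R\<close>, the factor \<open>K\<close> exceeds the coefficient of
  \<open>R\<close> in \<open>spread (2 * R) + R\<close>, so \<open>detour\<close> applies as soon as
  \<open>R\<close> is at least \<open>R0\<close>, which also ensures \<open>C0 \<le> R\<close>. The
  parameter \<open>1 / (K * C0)\<close> turns \<open>r\<close> into \<open>R / C0\<close>, the
  radius of the ball avoided by navigability. In the final constant, 1 is for a geodesic, the middle
  term for the two end pieces and the last one for the navigating path.\<close>

lemma linear_divergence_bound:
  fixes a b c :: 'a
  assumes geodesic: "geodesic_space TYPE('a)" and navigable: "navigable C0 k P"
    and detour: "\<And>a b c R.
           (\<forall>x\<in>{a, b}. kap + spread (2 * R) + R < dist c x \<and> R + spread kap \<le> dist c x) \<Longrightarrow>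
           polygonally_joined M {z. R \<le> dist c z} a b"
  defines "K \<equiv> 2 * lam\<^sup>2 + 2" and "R0 \<equiv> C0 + 2 * (lam\<^sup>2 * kap) + 2 * kap + 1"
  shows "divergence R0 a b c (1 / (K * C0))
    \<le> ennreal ((1 + 2 * (3 * linear_const + additive_const) + C0 * real (M + 2)) * dist a b)"
    (is "_ \<le> ennreal (?C * ?d)")
proof (rule divergence_leI)
  define r where "r = infdist c {a, b}"
  define R where "R = r / K"
  let ?A = "{x. 1 / (K * C0) * r - R0 \<le> dist c x}"
  let ?E = "3 * linear_const + additive_const"
  have C0: "1 \<le> C0" using navigable by (simp add: navigable_def)
  have lam2: "1 \<le> lam\<^sup>2" "0 \<le> lam\<^sup>2 * kap" using lam_kap by auto
  have K: "4 \<le> K" using lam2 by (simp add: K_def)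
  have r: "0 \<le> r" "r \<le> dist c a" "r \<le> dist c b"
    unfolding r_def by (auto simp: infdist_nonneg intro: infdist_le)
  have "min (dist c a) (dist c b) \<le> r" unfolding r_def by (rule infdist_geI) auto
  \<comment> \<open>One of the two points realizes \<open>r\<close>, and the other is at most
    \<open>?d\<close> farther from \<open>c\<close>.\<close>
  then have r_near: "dist c a \<le> r + ?d" "dist c b \<le> r + ?d"
    using dist_triangle[of c a b] dist_triangle[of c b a] by (auto simp: min_def dist_commute split: if_splits)
  have "r = K * R" using K by (simp add: R_def)
  then have rK: "r = 2 * (lam\<^sup>2 * R) + 2 * R" by (simp add: K_def algebra_simps)
  have R: "0 \<le> R" using r K by (simp add: R_def)
  have \<delta>r: "1 / (K * C0) * r = R / C0" by (simp add: R_def)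
  have RC0: "R / C0 \<le> R" using mult_right_mono[OF C0 R] C0 by (simp add: field_simps)
  have R0: "1 \<le> R0" "C0 \<le> R0" using C0 lam2 lam_kap by (auto simp: R0_def)
  have lamR: "R \<le> lam\<^sup>2 * R" using mult_right_mono[OF lam2(1) R] by simp
  show "joined_within ?A (ennreal (?C * ?d)) a b"
  proof (cases "R < R0 \<or> ?d \<le> r")
    case True
    have "joined_within ?A (ennreal ?d) a b"
    proof (rule joined_within_geodesic[OF geodesic])
      fix z assume z: "dist a z + dist z b = ?d"
      show "z \<in> ?A"
      \<comment> \<open>For small \<open>R\<close> the lower bound required of
        \<open>dist c z\<close> is not positive. Otherwise \<open>?d \<le> r\<close>, and adding the
        triangle inequalities through \<open>a\<close> and \<open>b\<close> shows that
        \<open>z\<close> is at distance at least \<open>r / 2\<close> from \<open>c\<close>.\<close>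
      proof (cases "R < R0")
        case True
        then have "R / C0 - R0 \<le> dist c z" using RC0 zero_le_dist[of c z] by linarith
        then show ?thesis using \<delta>r by simp
      next
        case False
        then have "2 * r \<le> 2 * dist c z + r"
          using True z r dist_triangle[of c a z] dist_triangle[of c b z] by (simp add: dist_commute)
        moreover have "2 * R \<le> r" using rK lamR R by linarith
        ultimately have "R / C0 - R0 \<le> dist c z" using RC0 R0 by linarith
        then show ?thesis using \<delta>r by simp
      qed
    qed
    moreover have "1 * ?d \<le> ?C * ?d" using const_nonneg C0 by (intro mult_right_mono) auto
    ultimately show ?thesis by (auto intro: joined_within_mono ennreal_leI)
  next
    case False
    then have big: "R0 \<le> R" "r < ?d" by auto
    have "2 * R \<le> r" "R \<le> r" using rK lamR R by linarith+
    obtain a' where a': "dist c a' = 2 * R" "polygonally_joined 1 {z. 2 * R \<le> dist c z} a a'"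
      "joined_within {z. 2 * R \<le> dist c z} (ennreal (linear_const * dist a a' + additive_const)) a a'"
      using approach[of "2 * R" c a] \<open>2 * R \<le> r\<close> r R by auto
    obtain b' where b': "dist c b' = 2 * R" "polygonally_joined 1 {z. 2 * R \<le> dist c z} b b'"
      "joined_within {z. 2 * R \<le> dist c z} (ennreal (linear_const * dist b b' + additive_const)) b' b"
      using approach[of "2 * R" c b] \<open>2 * R \<le> r\<close> r R by auto
    let ?B = "{z. R \<le> dist c z}"
    have sub: "{z. 2 * R \<le> dist c z} \<subseteq> ?B" using R by (intro Collect_mono) auto
    have ends: "polygonally_joined 1 ?B a' a" "polygonally_joined 1 ?B b b'"
      by (rule polygonally_joined_mono[OF polygonally_joined_sym[OF a'(2)] sub order_refl],
          rule polygonally_joined_mono[OF b'(2) sub order_refl])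
    have "polygonally_joined M ?B a b"
    proof (rule detour)
      \<comment> \<open>After cancelling \<open>2 * lam\<^sup>2 * R\<close>, the first inequality
        amounts to \<open>lam\<^sup>2 * kap + 2 * kap < R\<close>; the summands of \<open>R0\<close>
        are made for this and for the second one.\<close>
      have "kap + spread (2 * R) + R < r" "R + spread kap \<le> r"
        using big rK lamR lam2 lam_kap C0 unfolding spread_affine R0_def by linarith+
      then show "\<forall>x\<in>{a, b}. kap + spread (2 * R) + R < dist c x \<and> R + spread kap \<le> dist c x"
        using r by auto
    qed
    \<comment> \<open>Navigability requires endpoints within \<open>2 * R\<close> of
      \<open>c\<close>, which \<open>a\<close> and \<open>b\<close> need not be; hence the two extra
      sides.\<close>
    then have "polygonally_joined (1 + (M + 1)) ?B a' b'"
      by (rule polygonally_joined_trans[OF ends(1) polygonally_joined_trans[OF _ ends(2)]])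
    then obtain \<alpha> where \<alpha>: "polygonal_line (M + 2) P \<alpha>" "seg_start \<alpha> = a'" "seg_end \<alpha> = b'" "seg_image \<alpha> \<subseteq> ?B"
      unfolding polygonally_joined_def by auto
    have "R \<le> infdist c (seg_image \<alpha>)"
      using \<alpha> seg_image_nonempty[OF polygonal_line_is_path[OF \<alpha>(1)]] by (intro infdist_geI) auto
    then have "C0 \<le> R \<and> polygonal_line (M + 2) P \<alpha> \<and> R \<le> infdist c (seg_image \<alpha>) \<and>
        dist (seg_start \<alpha>) c \<le> 2 * R \<and> dist (seg_end \<alpha>) c \<le> 2 * R"
      using \<alpha> a'(1) b'(1) big R0 by (simp add: dist_commute)
    then have "\<exists>p. polygonal_line (k * (M + 2)) P p \<and> seg_start p = seg_start \<alpha> \<and>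
        seg_end p = seg_end \<alpha> \<and> seg_length p \<le> ennreal (C0 * real (M + 2) * R) \<and>
        seg_image p \<inter> cball c (R / C0) = {}"
      using navigable unfolding navigable_def by blast
    then obtain p where p: "polygonal_line (k * (M + 2)) P p" "seg_start p = a'" "seg_end p = b'"
      "seg_length p \<le> ennreal (C0 * real (M + 2) * R)" "seg_image p \<inter> cball c (R / C0) = {}"
      unfolding \<alpha>(2,3) by blast
    have AB: "{z. 2 * R \<le> dist c z} \<subseteq> ?A" using \<delta>r RC0 R R0 by (intro Collect_mono) auto
    have "R / C0 < dist c z" if "z \<in> seg_image p" for z
      using p(5) that by (auto simp: disjoint_iff)
    then have "seg_image p \<subseteq> ?A" unfolding \<delta>r using R0 by fastforce
    then have mid: "joined_within ?A (ennreal (C0 * real (M + 2) * R)) a' b'"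
      unfolding joined_within_def using p polygonal_line_is_path by blast
    \<comment> \<open>The additive constant is absorbed because \<open>?d\<close> exceeds
      \<open>r\<close>, which is at least \<open>R\<close>, and \<open>R0\<close> is at least
      1.\<close>
    have E: "linear_const * x + additive_const \<le> ?E * ?d" if "x \<le> 3 * ?d" for x
    proof -
      have "linear_const * x \<le> linear_const * (3 * ?d)" using that const_nonneg by (intro mult_left_mono)
      moreover have "additive_const * 1 \<le> additive_const * ?d"
        using big R0 \<open>R \<le> r\<close> const_nonneg by (intro mult_left_mono) auto
      ultimately show ?thesis by (simp add: algebra_simps)
    qed
    \<comment> \<open>Through \<open>c\<close>, these distances are at most
      \<open>(r + ?d) + 2 * R\<close>, where both \<open>r\<close> and \<open>2 * R\<close> are at
      most \<open>?d\<close>.\<close>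
    have "dist a a' \<le> 3 * ?d" "dist b b' \<le> 3 * ?d"
      using dist_triangle3[of a a' c] dist_triangle3[of b b' c] a'(1) b'(1) r_near \<open>2 * R \<le> r\<close> big
      by linarith+
    note E' = this[THEN E, THEN ennreal_leI]
    have "joined_within ?A (ennreal (?E * ?d)) a a'" "joined_within ?A (ennreal (?E * ?d)) b' b"
      by (rule joined_within_mono[OF a'(3) AB E'(1)], rule joined_within_mono[OF b'(3) AB E'(2)])
    then have "joined_within ?A (ennreal (?E * ?d) + (ennreal (C0 * real (M + 2) * R) + ennreal (?E * ?d))) a b"
      by (rule joined_within_trans[OF _ joined_within_trans[OF mid]])
    moreover have "ennreal (?E * ?d) + (ennreal (C0 * real (M + 2) * R) + ennreal (?E * ?d)) \<le> ennreal (?C * ?d)"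
    proof -
      have "C0 * real (M + 2) * R \<le> C0 * real (M + 2) * ?d"
        using big \<open>R \<le> r\<close> C0 by (intro mult_left_mono) auto
      moreover have "?C * ?d = ?d + (?E * ?d + (C0 * real (M + 2) * ?d + ?E * ?d))"
        by (simp add: algebra_simps)
      ultimately have "?E * ?d + (C0 * real (M + 2) * R + ?E * ?d) \<le> ?C * ?d"
        using zero_le_dist[of a b] by linarith
      moreover have "0 \<le> ?E * ?d" "0 \<le> C0 * real (M + 2) * R" using const_nonneg C0 R by auto
      ultimately show ?thesis by (simp only: ennreal_plus[symmetric] add_nonneg_nonneg ennreal_leI)
    qed
    ultimately show ?thesis by (rule joined_within_mono[OF _ order_refl])
  qed
qed

end

theorem theorem4p9:
  fixes P :: "'a::metric_space segment set"
    and lam0 kap0 C0 \<delta> eps C :: real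
    and k :: nat
    and nj :: "nat \<Rightarrow> real"
  assumes geodesic: "geodesic_space TYPE('a)"
    and system: "path_system lam0 kap0 P"
    and navigable: "navigable C0 k P"
    and undirected: "undirected P"
    and through_every_point:
      "\<forall>x. \<exists>h :: nat \<Rightarrow> 'a segment.
         (\<forall>j. h j \<in> P \<and> seg_image (h j) \<inter> cball x kap0 \<noteq> {}) \<and>
         filterlim (\<lambda>j. dist x (seg_start (h j))) at_top sequentially \<and>
         filterlim (\<lambda>j. dist x (seg_end (h j))) at_top sequentially"
    and delta: "0 < \<delta>" "\<delta> < 1"
    and eps: "0 < eps"
    and C: "0 < C"
    and nj: "filterlim nj at_top sequentially"
    and linear_along_nj: "\<forall>j. Divergence TYPE('a) eps (nj j) \<delta> \<le> ennreal (C * nj j)"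
  shows "\<exists>C' \<delta>' eps'. 0 < C' \<and> 0 < \<delta>' \<and> \<delta>' < 1 \<and> 0 < eps' \<and>
           (\<forall>n\<ge>0. Divergence TYPE('a) eps' n \<delta>' \<le> ennreal (C' * n))"
proof -
  interpret special_paths P lam0 kap0 by (standard; fact)
  obtain M where M: "polygonally_joined M {z. R \<le> dist c z} a b"
    if "\<forall>x\<in>{a, b}. kap0 + spread (2 * R) + R < dist c x \<and> R + spread kap0 \<le> dist c x" for a b c R
    using polygonal_detour[OF through_every_point delta(1) C nj linear_along_nj] by blast
  \<comment> \<open>The three constants are those of \<open>linear_divergence_bound\<close>; none of
    them depends on \<open>n\<close> or on the three points.\<close>
  define C' where "C' = 1 + 2 * (3 * linear_const + additive_const) + C0 * real (M + 2)"
  define \<delta>' where "\<delta>' = 1 / ((2 * lam0\<^sup>2 + 2) * C0)"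
  define eps' where "eps' = C0 + 2 * (lam0\<^sup>2 * kap0) + 2 * kap0 + 1"
  have C0: "1 \<le> C0" using navigable by (simp add: navigable_def)
  have C': "0 < C'" unfolding C'_def using const_nonneg C0 by (intro add_pos_nonneg) auto
  have "1 < 2 * lam0\<^sup>2 + 2" using zero_le_power2[of lam0] by linarith
  then have "1 * 1 < (2 * lam0\<^sup>2 + 2) * C0" using C0 by (intro mult_less_le_imp_less) auto
  then have \<delta>': "0 < \<delta>'" "\<delta>' < 1" by (auto simp: \<delta>'_def)
  have eps': "0 < eps'" using C0 lam_kap by (simp add: eps'_def add_pos_nonneg add_nonneg_pos)
  have "Divergence TYPE('a) eps' n \<delta>' \<le> ennreal (C' * n)" for n
    unfolding Divergence_def
  proof (rule SUP_least, clarify)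
    fix a b c :: 'a assume ab: "dist a b \<le> n"
    have "divergence eps' a b c \<delta>' \<le> ennreal (C' * dist a b)"
      unfolding eps'_def \<delta>'_def C'_def by (rule linear_divergence_bound[OF geodesic navigable M])
    also have "\<dots> \<le> ennreal (C' * n)" using ab C' by (intro ennreal_leI mult_left_mono) auto
    finally show "divergence eps' a b c \<delta>' \<le> ennreal (C' * n)" .
  qed
  then show ?thesis using C' \<delta>' eps' by blast
qed

end
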